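(* Assume there is $M>0$ with $|\log\hat\pi_k(x)|\le M$ for all $x\in\mathcal X$ and all $k\in[1,p]$. For each $k$ let $S_k=(x^k_1,\dots,x^k_{m_k})$ be drawn i.i.d. from $\mathsf p_k$, the samples $S_1,\dots,S_p$ being independent, and let $\hat{\mathsf p}_k$ be the empirical distribution of $S_k$. Then for any $\delta\in(0,1)$, with probability at least $1-\delta$, simultaneously for all $g\in\mathcal G_1$ and all $\lambda\in\Delta$, $$\mathbb E_{x\sim\mathsf p_\lambda}[-\log\pi_g(x)]\le\mathbb E_{x\sim\hat{\mathsf p}_\lambda}[-\log\pi_g(x)]+\sum_{k=1}^p\lambda_k\Big[2\sqrt2\,C_\Pi\,e^{M}\,\mathfrak R^k_{m_k}(\mathcal G_1)+M\sqrt{\frac{\log(p/\delta)}{2m_k}}\Big].$$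
   Context: Fix an integer $p\ge1$, $[1,p]=\{1,\dots,p\}$, $\Delta=\{\lambda\in\mathbb R^p:\lambda_k\ge0,\ \sum_k\lambda_k=1\}$. Let $\mathcal X$ be a countable set, $\mathsf p_1,\dots,\mathsf p_p$ probability distributions on $\mathcal X$, and $\hat\pi_1,\dots,\hat\pi_p$ probability distributions on $\mathcal X$ (experts). A gate is $g:\mathcal X\times[1,p]\to[0,1]$ with $\sum_kg(x,k)=1$ for each $x$; $\pi_g(x)=\sum_kg(x,k)\hat\pi_k(x)$, and $\mathcal G_1$ is the set of gates with $\sum_{x\in\mathcal X}\pi_g(x)=1$. Each $g$ is viewed as the vector-valued function $x\mapsto(g(x,1),\dots,g(x,p))\in\mathbb R^p$. For $\lambda\in\Delta$, $\mathsf p_\lambda=\sum_k\lambda_k\mathsf p_k$ and $\hat{\mathsf p}_\lambda=\sum_k\lambda_k\hat{\mathsf p}_k$. The (vector-valued) Rademacher complexity of $\mathcal G_1$ for $\mathsf p_k$ and sample size $m$ is $\mathfrak R^k_m(\mathcal G_1)=\mathbb E_{(x_1,\dots,x_m)\sim\mathsf p_k^m}\,\frac1m\mathbb E_{\sigma}\big[\sup_{g\in\mathcal G_1}\sum_{i=1}^m\sum_{j=1}^p\sigma_{i,j}g(x_i,j)\big]$, where the $\sigma_{i,j}$ are independent uniform $\{-1,+1\}$-valued random variables. The expert coincidence norm is $C_\Pi=\sup_{x\in\mathcal X}\|(\hat\pi_1(x),\dots,\hat\pi_p(x))\|_2$. *)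

theory Defs
  imports "HOL-Analysis.Analysis" "HOL-Probability.Probability"
begin

definition is_gate :: "nat \<Rightarrow> ('x \<Rightarrow> nat \<Rightarrow> real) \<Rightarrow> bool" where
  "is_gate p g \<longleftrightarrow> (\<forall>x. (\<forall>k\<in>{1..p}. 0 \<le> g x k \<and> g x k \<le> 1) \<and> (\<Sum>k=1..p. g x k) = 1)"

definition pi_g :: "nat \<Rightarrow> (nat \<Rightarrow> 'x pmf) \<Rightarrow> ('x \<Rightarrow> nat \<Rightarrow> real) \<Rightarrow> 'x \<Rightarrow> real" where
  "pi_g p pihat g x = (\<Sum>k=1..p. g x k * pmf (pihat k) x)"

definition G1 :: "nat \<Rightarrow> (nat \<Rightarrow> 'x pmf) \<Rightarrow> ('x \<Rightarrow> nat \<Rightarrow> real) set" where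
  "G1 p pihat = {g. is_gate p g \<and> infsum (pi_g p pihat g) UNIV = 1}"

definition lam_simplex :: "nat \<Rightarrow> (nat \<Rightarrow> real) set" where
  "lam_simplex p = {lam. (\<forall>k\<in>{1..p}. 0 \<le> lam k) \<and> (\<Sum>k=1..p. lam k) = 1}"

definition mix_pmf :: "nat \<Rightarrow> (nat \<Rightarrow> real) \<Rightarrow> (nat \<Rightarrow> 'x pmf) \<Rightarrow> 'x \<Rightarrow> real" where
  "mix_pmf p lam P x = (\<Sum>k=1..p. lam k * pmf (P k) x)"

definition empirical :: "nat \<Rightarrow> (nat \<Rightarrow> 'x) \<Rightarrow> 'x \<Rightarrow> real" where
  "empirical m xs x = real (card {i\<in>{0..<m}. xs i = x}) / real m"

definition expect_w :: "('x \<Rightarrow> real) \<Rightarrow> ('x \<Rightarrow> real) \<Rightarrow> real" where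
  "expect_w w f = infsum (\<lambda>x. w x * f x) UNIV"

definition rademacher :: "nat \<Rightarrow> ('x \<Rightarrow> nat \<Rightarrow> real) set \<Rightarrow> 'x pmf \<Rightarrow> nat \<Rightarrow> real" where
  "rademacher p G D m =
     measure_pmf.expectation (Pi_pmf {0..<m} undefined (\<lambda>_. D))
       (\<lambda>xs. (1 / real m) *
          measure_pmf.expectation (Pi_pmf ({0..<m} \<times> {1..p}) 0 (\<lambda>_. pmf_of_set {-1, 1::real}))
            (\<lambda>\<sigma>. SUP g\<in>G. (\<Sum>i<m. \<Sum>j=1..p. \<sigma> (i, j) * g (xs i) j)))"

definition C_Pi :: "nat \<Rightarrow> (nat \<Rightarrow> 'x pmf) \<Rightarrow> real" where
  "C_Pi p pihat = (SUP x. sqrt (\<Sum>k=1..p. (pmf (pihat k) x)\<^sup>2))"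

definition sample_pmf :: "nat \<Rightarrow> (nat \<Rightarrow> nat) \<Rightarrow> (nat \<Rightarrow> 'x pmf) \<Rightarrow> (nat \<Rightarrow> nat \<Rightarrow> 'x) pmf" where
  "sample_pmf p m P = Pi_pmf {1..p} undefined (\<lambda>k. Pi_pmf {0..<m k} undefined (\<lambda>_. P k))"

end

(* Since every expert charges each point with mass at least exp(-M), the sample space is finite, so all
   expectations are finite sums.  The losses -ln pi_g lie in [0, M] and are exp(M) C_Pi-Lipschitz in the
   vector of gate values.  Maurer's vector contraction, merged with symmetrization into one induction on the
   sample, bounds the expected supremum of the deviations; its constant sqrt 2 is the one in Khintchine's
   L1-L2 inequality, proved after Latala and Oleszkiewicz: f = |sum_j v_j s_j| is even, so that it
   satisfies a Poincare inequality with doubled spectral gap, while the triangle inequality bounds its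
   Dirichlet energy by E f^2.  McDiarmid's inequality and a union bound over the components conclude, and
   the bound for a mixture is the convex combination of the bounds for the components. *)

theory Submission
  imports Defs
begin

section \<open>Finite expectations over product distributions\<close>

lemma finite_set_Pi_pmf:
  assumes "finite A" "\<And>x. x \<in> A \<Longrightarrow> finite (set_pmf (D x))"
  shows "finite (set_pmf (Pi_pmf A d D))"
  using assms by (auto simp: set_Pi_pmf intro!: finite_PiE_dflt)

lemma expectation_mono_finite:
  fixes f g :: "'a \<Rightarrow> real"
  assumes "finite (set_pmf D)" "\<And>x. x \<in> set_pmf D \<Longrightarrow> f x \<le> g x"
  shows "measure_pmf.expectation D f \<le> measure_pmf.expectation D g"
  using assms by (intro integral_mono_AE integrable_measure_pmf_finite) (auto simp: AE_measure_pmf_iff)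

text \<open>Fubini for a product with one more factor. The new coordinate is integrated innermost,
  with the others frozen, which is the form the inductions on the index set require.\<close>

lemma expectation_Pi_pmf_insert:
  fixes f :: "('a \<Rightarrow> 'b) \<Rightarrow> real"
  assumes A: "finite A" "a \<notin> A" and D: "\<And>x. x \<in> insert a A \<Longrightarrow> finite (set_pmf (D x))"
  shows "measure_pmf.expectation (Pi_pmf (insert a A) d D) f =
    measure_pmf.expectation (Pi_pmf A d D) (\<lambda>s. measure_pmf.expectation (D a) (\<lambda>x. f (s(a := x))))"
proof -
  have fin: "finite (set_pmf (Pi_pmf A d D))"
    using A D by (intro finite_set_Pi_pmf) auto
  have "Pi_pmf (insert a A) d D = Pi_pmf A d D \<bind> (\<lambda>s. map_pmf (\<lambda>x. s(a := x)) (D a))"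
    using A by (subst Pi_pmf_insert') (auto simp: map_pmf_def intro: bind_commute_pmf)
  then show ?thesis
    using D fin
    by (subst integral_measure_pmf[OF fin]) (auto simp: pmf_expectation_bind[OF fin])
qed

lemma expectation_swap_finite:
  fixes f :: "'a \<Rightarrow> 'b \<Rightarrow> real"
  assumes "finite (set_pmf D)" "finite (set_pmf E)"
  shows "measure_pmf.expectation D (\<lambda>x. measure_pmf.expectation E (f x)) =
         measure_pmf.expectation E (\<lambda>y. measure_pmf.expectation D (\<lambda>x. f x y))"
  using sum.swap[of "\<lambda>x y. pmf D x * (pmf E y * f x y)" "set_pmf E" "set_pmf D"]
  by (simp add: integral_measure_pmf[OF assms(1)] integral_measure_pmf[OF assms(2)]
      sum_distrib_left mult.left_commute)

section \<open>Rademacher averages\<close>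

text \<open>The same average as the inner expectation in \<open>rademacher\<close>, default value 0
  included, but over any index set, so that inductions can remove one sign at a time.\<close>

definition sign_avg :: "'i set \<Rightarrow> (('i \<Rightarrow> real) \<Rightarrow> real) \<Rightarrow> real" where
  "sign_avg A f = measure_pmf.expectation (Pi_pmf A 0 (\<lambda>_. pmf_of_set {-1, 1})) f"

lemma sign_avg_empty [simp]: "sign_avg {} f = f (\<lambda>_. 0)"
  by (simp add: sign_avg_def)

lemma sign_avg_insert:
  assumes "finite A" "a \<notin> A"
  shows "sign_avg (insert a A) f = sign_avg A (\<lambda>s. (f (s(a := 1)) + f (s(a := -1))) / 2)"
  unfolding sign_avg_def using assms
  by (subst expectation_Pi_pmf_insert) (auto simp: integral_pmf_of_set add.commute)

context
  fixes A :: "'i set"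
  assumes A: "finite A"
begin

lemma integrable_signs:
  "integrable (measure_pmf (Pi_pmf A 0 (\<lambda>_. pmf_of_set {-1, 1 :: real}))) (f :: _ \<Rightarrow> real)"
  using A by (intro integrable_measure_pmf_finite finite_set_Pi_pmf) auto

lemma sign_avg_mono:
  assumes "\<And>s. f s \<le> g s"
  shows "sign_avg A f \<le> sign_avg A g"
  unfolding sign_avg_def using assms by (intro integral_mono integrable_signs)

lemma sign_avg_nonneg: "(\<And>s. 0 \<le> f s) \<Longrightarrow> 0 \<le> sign_avg A f"
  unfolding sign_avg_def by simp

lemma sign_avg_add: "sign_avg A (\<lambda>s. f s + g s) = sign_avg A f + sign_avg A g"
  unfolding sign_avg_def by (intro Bochner_Integration.integral_add integrable_signs)

lemma sign_avg_sum: "sign_avg A (\<lambda>s. \<Sum>i\<in>B. f i s) = (\<Sum>i\<in>B. sign_avg A (f i))"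
  unfolding sign_avg_def by (intro Bochner_Integration.integral_sum integrable_signs)

lemma sign_avg_cmult: "sign_avg A (\<lambda>s. c * f s) = c * sign_avg A f"
  unfolding sign_avg_def by simp

lemma sign_avg_uminus: "sign_avg A (\<lambda>s. - f s) = - sign_avg A f"
  unfolding sign_avg_def by simp

lemma sign_avg_divide: "sign_avg A (\<lambda>s. f s / c) = sign_avg A f / c"
  unfolding sign_avg_def by simp

lemma sign_avg_const [simp]: "sign_avg A (\<lambda>_. c) = c"
  unfolding sign_avg_def by simp

end

text \<open>Reflection exchanges the two values averaged in each coordinate and fixes the default
  value 0 outside \<open>A\<close>.\<close>

lemma sign_avg_reflect:
  assumes "finite A"
  shows "sign_avg A (\<lambda>s. f (\<lambda>i. - s i)) = sign_avg A f"
  using assms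
proof (induction A arbitrary: f rule: finite_induct)
  case (insert a A)
  have upd: "(\<lambda>i. - (s(a := c)) i) = (\<lambda>i. - s i)(a := - c)" for s and c :: real
    by auto
  show ?case
    using insert.IH[of "\<lambda>s. (f (s(a := -1)) + f (s(a := 1))) / 2"] insert.hyps
    by (simp add: sign_avg_insert upd add.commute del: fun_upd_apply)
qed simp

text \<open>Independent blocks of signs can be averaged one after the other. This later joins the
  signs of a new sample point to the earlier ones.\<close>

lemma sign_avg_union:
  assumes "finite A" "finite B" "A \<inter> B = {}"
  shows "sign_avg (A \<union> B) f = sign_avg A (\<lambda>s. sign_avg B (\<lambda>t. f (\<lambda>i. if i \<in> A then s i else t i)))"
  using assms(1,3)
proof (induction A arbitrary: f rule: finite_induct)
  case (insert a A)
  have upd: "(\<lambda>i. if i \<in> insert a A then (s(a := c)) i else t i) =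
      (\<lambda>i. if i \<in> A then s i else t i)(a := c)" for s t and c :: real
    using insert.hyps by auto
  have "sign_avg (insert a A \<union> B) f = sign_avg (A \<union> B) (\<lambda>s. (f (s(a := 1)) + f (s(a := -1))) / 2)"
    using insert assms by (simp add: sign_avg_insert)
  also have "\<dots> = sign_avg (insert a A) (\<lambda>s. sign_avg B (\<lambda>t. f (\<lambda>i. if i \<in> insert a A then s i else t i)))"
    using insert.prems by (subst insert.IH)
      (auto simp: sign_avg_insert insert.hyps upd sign_avg_add sign_avg_divide assms simp del: fun_upd_apply insert_iff)
  finally show ?case .
qed (use assms(2) in simp)

section \<open>Khintchine's inequality with the optimal constant\<close>

text \<open>The discrete derivative in direction \<open>i\<close>: of the Walsh monomials it keeps
  those containing \<open>s i\<close> and strips that factor.\<close>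

definition half_diff :: "'i \<Rightarrow> (('i \<Rightarrow> real) \<Rightarrow> real) \<Rightarrow> ('i \<Rightarrow> real) \<Rightarrow> real" where
  "half_diff i f s = (f (s(i := 1)) - f (s(i := -1))) / 2"

text \<open>On the cube, \<open>f s\<close> is \<open>u f s + s a * w f s\<close>, and neither
  \<open>u f\<close> nor \<open>w f\<close> depends on coordinate \<open>a\<close>. As
  \<open>s a\<close> has mean 0 and square 1, all cross terms vanish.\<close>

lemma sum_square_half_diff_insert:
  assumes A: "finite A" "a \<notin> A"
  defines "u \<equiv> \<lambda>f s. (f (s(a := 1)) + f (s(a := -1))) / (2 :: real)"
  defines "w \<equiv> half_diff a"
  shows "sign_avg (insert a A) f = sign_avg A (u f)"
    and "sign_avg (insert a A) (\<lambda>s. (f s)\<^sup>2) = sign_avg A (\<lambda>s. (u f s)\<^sup>2) + sign_avg A (\<lambda>s. (w f s)\<^sup>2)"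
    and "(\<Sum>i\<in>insert a A. sign_avg (insert a A) (\<lambda>s. (half_diff i f s)\<^sup>2)) =
      (\<Sum>i\<in>A. sign_avg A (\<lambda>s. (half_diff i (u f) s)\<^sup>2)) +
      (\<Sum>i\<in>A. sign_avg A (\<lambda>s. (half_diff i (w f) s)\<^sup>2)) + sign_avg A (\<lambda>s. (w f s)\<^sup>2)"
    and "(\<Sum>i\<in>insert a A. (sign_avg (insert a A) (half_diff i f))\<^sup>2) =
      (\<Sum>i\<in>A. (sign_avg A (half_diff i (u f)))\<^sup>2) + (sign_avg A (w f))\<^sup>2"
proof -
  have sq: "sign_avg (insert a A) (\<lambda>s. (f s)\<^sup>2) =
      sign_avg A (\<lambda>s. (u f s)\<^sup>2) + sign_avg A (\<lambda>s. (w f s)\<^sup>2)" for f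
  proof -
    have "((f (s(a := 1)))\<^sup>2 + (f (s(a := -1)))\<^sup>2) / 2 = (u f s)\<^sup>2 + (w f s)\<^sup>2" for s
      by (simp add: u_def w_def half_diff_def power2_eq_square field_simps)
    then show ?thesis
      by (simp only: sign_avg_insert[OF A] sign_avg_add[OF A(1), symmetric])
  qed
  then show "sign_avg (insert a A) (\<lambda>s. (f s)\<^sup>2) =
      sign_avg A (\<lambda>s. (u f s)\<^sup>2) + sign_avg A (\<lambda>s. (w f s)\<^sup>2)" .
  show avg: "sign_avg (insert a A) f = sign_avg A (u f)" for f
    by (simp add: sign_avg_insert A u_def)
  \<comment> \<open>Averages and differences in distinct coordinates commute.\<close>
  have comm: "u (half_diff i f) = half_diff i (u f)" "w (half_diff i f) = half_diff i (w f)"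
    if "i \<in> A" for i
  proof -
    have twist: "s(a := x, i := y) = s(i := y, a := x)" for s :: "'a \<Rightarrow> real" and x y
      using that A by (intro fun_upd_twist) auto
    show "u (half_diff i f) = half_diff i (u f)" "w (half_diff i f) = half_diff i (w f)"
      by (auto simp: u_def w_def half_diff_def fun_eq_iff field_simps twist)
  qed
  \<comment> \<open>\<open>half_diff a f\<close> ignores coordinate \<open>a\<close>: averaging over
    it changes nothing and differencing gives 0. Hence the last term of each of the two
    identities.\<close>
  have "u (half_diff a f) = w f" and "w (half_diff a f) = (\<lambda>_. 0)"
    by (auto simp: u_def w_def half_diff_def fun_eq_iff)
  with comm show "(\<Sum>i\<in>insert a A. sign_avg (insert a A) (\<lambda>s. (half_diff i f s)\<^sup>2)) =
      (\<Sum>i\<in>A. sign_avg A (\<lambda>s. (half_diff i (u f) s)\<^sup>2)) +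
      (\<Sum>i\<in>A. sign_avg A (\<lambda>s. (half_diff i (w f) s)\<^sup>2)) + sign_avg A (\<lambda>s. (w f s)\<^sup>2)"
    and "(\<Sum>i\<in>insert a A. (sign_avg (insert a A) (half_diff i f))\<^sup>2) =
      (\<Sum>i\<in>A. (sign_avg A (half_diff i (u f)))\<^sup>2) + (sign_avg A (w f))\<^sup>2"
    using A by (simp_all add: sq avg sum.distrib)
qed

text \<open>The induction hypothesis is applied to the average over the new sign; the energy of
  \<open>half_diff a f\<close> in the old directions is nonnegative and dropped.\<close>

lemma poincare_cube:
  assumes "finite A"
  shows "sign_avg A (\<lambda>s. (f s)\<^sup>2) \<le> (sign_avg A f)\<^sup>2 + (\<Sum>i\<in>A. sign_avg A (\<lambda>s. (half_diff i f s)\<^sup>2))"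
  using assms
proof (induction A arbitrary: f rule: finite_induct)
  case (insert a A)
  have "0 \<le> (\<Sum>i\<in>A. sign_avg A (\<lambda>s. (half_diff i (half_diff a f) s)\<^sup>2))"
    using insert.hyps by (intro sum_nonneg sign_avg_nonneg) auto
  then show ?case
    using insert.IH[of "\<lambda>s. (f (s(a := 1)) + f (s(a := -1))) / 2"]
    by (simp only: sum_square_half_diff_insert[OF insert.hyps, of f])
qed simp

text \<open>The spectral gap doubles once the level-one Walsh coefficients, which are the averages of the
  \<open>half_diff i f\<close>, are taken care of.\<close>

lemma poincare_cube_level_two:
  assumes "finite A"
  shows "2 * (sign_avg A (\<lambda>s. (f s)\<^sup>2) - (sign_avg A f)\<^sup>2) \<le>
    (\<Sum>i\<in>A. sign_avg A (\<lambda>s. (half_diff i f s)\<^sup>2)) + (\<Sum>i\<in>A. (sign_avg A (half_diff i f))\<^sup>2)"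
  using assms
proof (induction A arbitrary: f rule: finite_induct)
  case (insert a A)
  show ?case
    \<comment> \<open>Of the two copies of the second moment of \<open>half_diff a f\<close>, one
      belongs to the energy. The plain Poincare inequality bounds the other, and the squared mean in
      it is the new level-one term.\<close>
    using insert.IH[of "\<lambda>s. (f (s(a := 1)) + f (s(a := -1))) / 2"]
      poincare_cube[OF insert.hyps(1), of "half_diff a f"]
    unfolding sum_square_half_diff_insert[OF insert.hyps, of f] right_diff_distrib distrib_left by linarith
qed simp

text \<open>The derivative of an even function is odd, so its average equals its own
  negative.\<close>

lemma sign_avg_half_diff_even:
  assumes "finite A" and even: "\<And>s. f (\<lambda>i. - s i) = f s"
  shows "sign_avg A (half_diff i f) = 0"
proof -
  have "half_diff i f (\<lambda>k. - s k) = - half_diff i f s" for s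
    using even[of "s(i := 1)"] even[of "s(i := -1)"]
    by (simp add: half_diff_def fun_upd_def if_distrib cong: if_cong) (simp add: field_simps)
  then show ?thesis
    using sign_avg_reflect[OF assms(1), of "half_diff i f"] assms(1) by (simp add: sign_avg_uminus)
qed

text \<open>The mean of \<open>x * (x - y)\<close> and \<open>y * (y - x)\<close> is half the square
  of \<open>x - y\<close>. In this form the energy can be summed over \<open>i\<close> pointwise,
  before averaging.\<close>

lemma sign_avg_half_diff_square:
  assumes "finite A" "i \<in> A"
  shows "sign_avg A (\<lambda>s. (half_diff i f s)\<^sup>2) = sign_avg A (\<lambda>s. f s * (f s - f (s(i := - s i)))) / 2"
proof -
  obtain B where B: "A = insert i B" "i \<notin> B" "finite B"
    using assms by (metis Set.set_insert finite_insert)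
  then show ?thesis
    by (simp add: sign_avg_insert half_diff_def sign_avg_divide[symmetric] power2_eq_square)
       (simp add: field_simps)
qed

text \<open>Distinct signs are orthogonal. The constant \<open>c\<close> serves the induction: it
  absorbs the term of the removed sign.\<close>

lemma sign_avg_linear_square:
  assumes "finite A"
  shows "sign_avg A (\<lambda>s. (c + (\<Sum>j\<in>A. v j * s j))\<^sup>2) = c\<^sup>2 + (\<Sum>j\<in>A. (v j)\<^sup>2)"
  using assms
proof (induction A arbitrary: c rule: finite_induct)
  case (insert a A)
  have sum_upd: "(\<Sum>j\<in>A. v j * (s(a := x)) j) = (\<Sum>j\<in>A. v j * s j)" for s x
    using insert.hyps by (intro sum.cong) auto
  have "sign_avg (insert a A) (\<lambda>s. (c + (\<Sum>j\<in>insert a A. v j * s j))\<^sup>2) =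
      sign_avg A (\<lambda>s. ((c + v a + (\<Sum>j\<in>A. v j * s j))\<^sup>2 + (c - v a + (\<Sum>j\<in>A. v j * s j))\<^sup>2) / 2)"
    using insert.hyps by (simp add: sign_avg_insert sum_upd algebra_simps del: fun_upd_apply)
       (simp add: algebra_simps)
  also have "\<dots> = ((c + v a)\<^sup>2 + (c - v a)\<^sup>2) / 2 + (\<Sum>j\<in>A. (v j)\<^sup>2)"
    using insert by (simp add: sign_avg_add sign_avg_divide)
  also have "\<dots> = c\<^sup>2 + (\<Sum>j\<in>insert a A. (v j)\<^sup>2)"
    using insert.hyps by (simp add: power2_eq_square field_simps)
  finally show ?case .
qed simp

lemma khintchine_L1_L2:
  assumes A: "finite A"
  shows "sqrt (\<Sum>j\<in>A. (v j)\<^sup>2) \<le> sqrt 2 * sign_avg A (\<lambda>s. \<bar>\<Sum>j\<in>A. v j * s j\<bar>)"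
proof -
  define S where "S = (\<lambda>s. \<Sum>j\<in>A. v j * s j)"
  define f where "f = (\<lambda>s. \<bar>S s\<bar>)"
  have flip: "S (s(i := - s i)) = S s - 2 * (v i * s i)" if "i \<in> A" for s i
    using that A unfolding S_def by (simp add: sum.remove[of A i] del: fun_upd_apply) (simp add: algebra_simps)
  have pointwise: "(\<Sum>i\<in>A. f s * (f s - f (s(i := - s i)))) \<le> 2 * (f s)\<^sup>2" for s
  proof -
    \<comment> \<open>Each term \<open>v j * s j\<close> is negated in exactly one of the
      \<open>card A\<close> flipped sums.\<close>
    have "(\<Sum>i\<in>A. S (s(i := - s i))) = (real (card A) - 2) * S s"
      by (simp add: flip sum_subtractf sum_distrib_left[symmetric] left_diff_distrib)
        (simp add: S_def)
    \<comment> \<open>If \<open>A\<close> has fewer than two elements, the left side is nonpositive,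
      so no case distinction arises.\<close>
    then have "(real (card A) - 2) * f s \<le> \<bar>\<Sum>i\<in>A. S (s(i := - s i))\<bar>"
      by (simp add: f_def abs_mult mult_right_mono)
    also have "\<dots> \<le> (\<Sum>i\<in>A. f (s(i := - s i)))"
      unfolding f_def by (rule sum_abs)
    finally have "f s * (\<Sum>i\<in>A. f s - f (s(i := - s i))) \<le> f s * (2 * f s)"
      by (intro mult_left_mono) (auto simp: sum_subtractf f_def left_diff_distrib)
    then show ?thesis
      by (simp add: sum_distrib_left power2_eq_square)
  qed
  have "(\<Sum>i\<in>A. sign_avg A (\<lambda>s. (half_diff i f s)\<^sup>2)) =
      sign_avg A (\<lambda>s. \<Sum>i\<in>A. f s * (f s - f (s(i := - s i)))) / 2"
    using A by (simp add: sign_avg_half_diff_square sign_avg_sum sum_divide_distrib)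
  also have "\<dots> \<le> sign_avg A (\<lambda>s. 2 * (f s)\<^sup>2) / 2"
    using A pointwise by (intro divide_right_mono sign_avg_mono) auto
  also have "\<dots> = sign_avg A (\<lambda>s. (f s)\<^sup>2)"
    using A by (simp add: sign_avg_cmult)
  finally have energy: "(\<Sum>i\<in>A. sign_avg A (\<lambda>s. (half_diff i f s)\<^sup>2)) \<le> sign_avg A (\<lambda>s. (f s)\<^sup>2)" .
  have "f (\<lambda>i. - s i) = f s" for s
    by (simp add: f_def S_def sum_negf)
  then have "(\<Sum>i\<in>A. (sign_avg A (half_diff i f))\<^sup>2) = 0"
    using A by (simp add: sign_avg_half_diff_even)
  \<comment> \<open>Twice the variance of \<open>f\<close> is at most its second moment, which
    rearranges to the constant 2.\<close>
  then have "sign_avg A (\<lambda>s. (f s)\<^sup>2) \<le> 2 * (sign_avg A f)\<^sup>2"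
    using poincare_cube_level_two[OF A, of f] energy unfolding right_diff_distrib by linarith
  moreover have "sign_avg A (\<lambda>s. (f s)\<^sup>2) = (\<Sum>j\<in>A. (v j)\<^sup>2)"
    using sign_avg_linear_square[OF A, of 0 v] by (simp add: f_def S_def)
  ultimately have "sqrt (\<Sum>j\<in>A. (v j)\<^sup>2) \<le> sqrt (2 * (sign_avg A f)\<^sup>2)"
    by simp
  also have "\<dots> = sqrt 2 * sign_avg A f"
    using A by (simp add: real_sqrt_mult sign_avg_nonneg f_def)
  finally show ?thesis
    by (simp add: f_def S_def)
qed

section \<open>Symmetrization and vector contraction\<close>

lemma bounded_cmult_comp:
  fixes f :: "'a \<Rightarrow> real"
  assumes "bounded (f ` S)"
  shows "bounded ((\<lambda>x. c * f x) ` S)"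
  using bounded_scaling[OF assms, of c] by (simp add: image_image)

lemma bounded_sum_comp:
  fixes f :: "'i \<Rightarrow> 'a \<Rightarrow> real"
  assumes "\<And>i. i \<in> I \<Longrightarrow> bounded (f i ` S)"
  shows "bounded ((\<lambda>x. \<Sum>i\<in>I. f i x) ` S)"
  using assms
proof (induction I rule: infinite_finite_induct)
  case (insert i I)
  then show ?case
    using bounded_plus_comp[of "f i" S "\<lambda>x. \<Sum>i\<in>I. f i x"] by simp
qed (auto simp: image_constant_conv)

lemma bounded_const_comp: "bounded ((\<lambda>_. c :: real) ` S)"
  by (auto simp: image_constant_conv)

lemmas bounded_comp = bounded_plus_comp bounded_minus_comp bounded_cmult_comp bounded_sum_comp
  bounded_const_comp

text \<open>A real supremum is meaningful only over a family bounded above. Two-sided boundedness is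
  carried instead because it survives negation and differences.\<close>

lemma bounded_imp_le_SUP:
  fixes f :: "'a \<Rightarrow> real"
  assumes "bounded (f ` G)" "g \<in> G"
  shows "f g \<le> (SUP g\<in>G. f g)"
  using assms by (intro cSUP_upper bounded_imp_bdd_above)

text \<open>Khintchine's inequality replaces the Euclidean norm in the Lipschitz condition by an average over
  signs; by symmetry of the signs the absolute value can then be split over the two suprema.\<close>

lemma contraction_step:
  fixes h B :: "'g \<Rightarrow> real" and v :: "'g \<Rightarrow> 'j \<Rightarrow> real"
  assumes J: "finite J" and G: "G \<noteq> {}" and L: "0 \<le> L"
    and lip: "\<And>g g'. g \<in> G \<Longrightarrow> g' \<in> G \<Longrightarrow> h g - h g' \<le> L * sqrt (\<Sum>j\<in>J. (v g j - v g' j)\<^sup>2)"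
    and B: "bounded (B ` G)" and v: "\<And>j. j \<in> J \<Longrightarrow> bounded ((\<lambda>g. v g j) ` G)"
  shows "((SUP g\<in>G. h g + B g) + (SUP g\<in>G. - h g + B g)) / 2 \<le>
    sign_avg J (\<lambda>s. SUP g\<in>G. sqrt 2 * L * (\<Sum>j\<in>J. s j * v g j) + B g)"
proof -
  define T where "T s g = (\<Sum>j\<in>J. s j * v g j)" for s g
  define \<Phi> where "\<Phi> s = (SUP g\<in>G. sqrt 2 * L * T s g + B g)" for s
  have \<Phi>_upper: "sqrt 2 * L * T s g + B g \<le> \<Phi> s" if "g \<in> G" for s g
    unfolding \<Phi>_def using that v B
    by (intro bounded_imp_le_SUP[where f = "\<lambda>g. sqrt 2 * L * T s g + B g"]) (auto simp: T_def intro!: bounded_comp)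
  have T_neg: "T (\<lambda>j. - s j) g = - T s g" for s g
    by (simp add: T_def sum_negf)
  \<comment> \<open>It suffices to treat a fixed pair \<open>g\<close>, \<open>g'\<close>; the two
    suprema are taken one after the other at the end.\<close>
  have pair: "(h g + B g) + (- h g' + B g') \<le> 2 * sign_avg J \<Phi>" if g: "g \<in> G" "g' \<in> G" for g g'
  proof -
    have "h g - h g' \<le> L * (sqrt 2 * sign_avg J (\<lambda>s. \<bar>\<Sum>j\<in>J. (v g j - v g' j) * s j\<bar>))"
      using lip[OF g] mult_left_mono[OF khintchine_L1_L2[OF J, of "\<lambda>j. v g j - v g' j"] L] by linarith
    also have "(\<lambda>s. \<bar>\<Sum>j\<in>J. (v g j - v g' j) * s j\<bar>) = (\<lambda>s. \<bar>T s g - T s g'\<bar>)"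
      by (simp add: T_def sum_subtractf[symmetric] algebra_simps)
    finally have "(h g + B g) + (- h g' + B g') \<le>
        sign_avg J (\<lambda>s. sqrt 2 * L * \<bar>T s g - T s g'\<bar> + (B g + B g'))"
      by (simp add: sign_avg_add sign_avg_cmult J mult_ac)
    also have "\<dots> \<le> sign_avg J (\<lambda>s. \<Phi> s + \<Phi> (\<lambda>j. - s j))"
    proof (rule sign_avg_mono[OF J])
      fix s
      \<comment> \<open>The larger of \<open>T s g\<close> and \<open>T s g'\<close> is paired with
        \<open>s\<close>, the smaller with the reflected signs, under which \<open>T\<close> is
        negated.\<close>
      show "sqrt 2 * L * \<bar>T s g - T s g'\<bar> + (B g + B g') \<le> \<Phi> s + \<Phi> (\<lambda>j. - s j)"
        using \<Phi>_upper[OF g(1), of s] \<Phi>_upper[OF g(2), of s]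
          \<Phi>_upper[OF g(1), of "\<lambda>j. - s j"] \<Phi>_upper[OF g(2), of "\<lambda>j. - s j"]
        by (cases "T s g \<ge> T s g'") (simp_all add: T_neg right_diff_distrib)
    qed
    also have "\<dots> = 2 * sign_avg J \<Phi>"
      by (simp add: sign_avg_add sign_avg_reflect J)
    finally show ?thesis .
  qed
  have "(SUP g\<in>G. h g + B g) \<le> 2 * sign_avg J \<Phi> - (- h g' + B g')" if "g' \<in> G" for g'
    using G pair that by (intro cSUP_least) (auto simp: algebra_simps)
  then have "(SUP g\<in>G. - h g + B g) \<le> 2 * sign_avg J \<Phi> - (SUP g\<in>G. h g + B g)"
    using G by (intro cSUP_least) (auto simp: algebra_simps)
  then show ?thesis
    by (simp add: \<Phi>_def[abs_def] T_def)
qed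

text \<open>Averaging over \<open>x\<close> identifies a ghost sample point with \<open>x\<close> itself, so that no ghost sample needs
  to be carried along.\<close>

lemma symmetrization_step:
  fixes f :: "'g \<Rightarrow> 'x \<Rightarrow> real" and v :: "'g \<Rightarrow> 'x \<Rightarrow> 'j \<Rightarrow> real"
  assumes D: "finite (set_pmf D)" and J: "finite J" and G: "G \<noteq> {}" and L: "0 \<le> L"
    and lip: "\<And>g g' x. g \<in> G \<Longrightarrow> g' \<in> G \<Longrightarrow> f g x - f g' x \<le> L * sqrt (\<Sum>j\<in>J. (v g x j - v g' x j)\<^sup>2)"
    and B: "bounded (B ` G)" and f: "\<And>x. bounded ((\<lambda>g. f g x) ` G)"
    and v: "\<And>x j. j \<in> J \<Longrightarrow> bounded ((\<lambda>g. v g x j) ` G)"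
  shows "measure_pmf.expectation D (\<lambda>x. SUP g\<in>G. (measure_pmf.expectation D (f g) - f g x) + B g) \<le>
    measure_pmf.expectation D (\<lambda>x. sign_avg J
      (\<lambda>s. SUP g\<in>G. 2 * sqrt 2 * L * (\<Sum>j\<in>J. s j * v g x j) + B g))"
proof -
  \<comment> \<open>The doubling splits the deviation: half of \<open>U\<close> accounts for the
    mean, half of \<open>V\<close> for the sample value, each with half of \<open>B\<close>.\<close>
  define U where "U x = (SUP g\<in>G. 2 * f g x + B g)" for x
  define V where "V x = (SUP g\<in>G. - (2 * f g x) + B g)" for x
  note [intro!] = integrable_measure_pmf_finite[OF D]
  have U: "2 * f g x + B g \<le> U x" if "g \<in> G" for g x
    unfolding U_def using that B f
    by (intro bounded_imp_le_SUP[where f = "\<lambda>g. 2 * f g x + B g"]) (auto intro!: bounded_comp)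
  have V: "- (2 * f g x) + B g \<le> V x" if "g \<in> G" for g x
    unfolding V_def using that bounded_plus_comp[OF bounded_cmult_comp[OF f, of "-2"] B]
    by (intro bounded_imp_le_SUP[where f = "\<lambda>g. - (2 * f g x) + B g"]) simp
  have "(SUP g\<in>G. (measure_pmf.expectation D (f g) - f g x) + B g) \<le> (measure_pmf.expectation D U + V x) / 2" for x
  proof (rule cSUP_least[OF G])
    fix g assume g: "g \<in> G"
    have "2 * measure_pmf.expectation D (f g) + B g = measure_pmf.expectation D (\<lambda>x. 2 * f g x + B g)"
      by (subst Bochner_Integration.integral_add) auto
    also have "\<dots> \<le> measure_pmf.expectation D U"
      using U[OF g] by (intro integral_mono) auto
    finally show "(measure_pmf.expectation D (f g) - f g x) + B g \<le> (measure_pmf.expectation D U + V x) / 2"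
      using V[OF g, of x] by simp
  qed
  then have "measure_pmf.expectation D (\<lambda>x. SUP g\<in>G. (measure_pmf.expectation D (f g) - f g x) + B g) \<le>
      measure_pmf.expectation D (\<lambda>x. (measure_pmf.expectation D U + V x) / 2)"
    by (intro integral_mono) auto
  also have "\<dots> = measure_pmf.expectation D (\<lambda>x. (U x + V x) / 2)"
    by (simp add: Bochner_Integration.integral_add[OF integrable_measure_pmf_finite[OF D] integrable_measure_pmf_finite[OF D]])
  also have "\<dots> \<le> measure_pmf.expectation D (\<lambda>x. sign_avg J
      (\<lambda>s. SUP g\<in>G. 2 * sqrt 2 * L * (\<Sum>j\<in>J. s j * v g x j) + B g))"
  proof (intro integral_mono)
    fix x
    \<comment> \<open>The doubled loss has Lipschitz constant \<open>2 * L\<close>, whence the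
      factor 2 in \<open>2 * sqrt 2 * L\<close>.\<close>
    have "2 * f g x - 2 * f g' x \<le> 2 * L * sqrt (\<Sum>j\<in>J. (v g x j - v g' x j)\<^sup>2)"
      if "g \<in> G" "g' \<in> G" for g g'
      using lip[OF that, of x] by simp
    then show "(U x + V x) / 2 \<le> sign_avg J
        (\<lambda>s. SUP g\<in>G. 2 * sqrt 2 * L * (\<Sum>j\<in>J. s j * v g x j) + B g)"
      using contraction_step[OF J G, of "2 * L" "\<lambda>g. 2 * f g x" "\<lambda>g. v g x" B] L B v
      by (simp add: U_def V_def mult_ac)
  qed auto
  finally show ?thesis .
qed

text \<open>Induction on the sample with an arbitrary offset \<open>B\<close>. The offset first
  holds the deviation of the point not yet symmetrized, then the Rademacher sums already produced,
  so each step is the one-point case.\<close>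

lemma symmetrization_contraction:
  fixes f :: "'g \<Rightarrow> 'x \<Rightarrow> real" and v :: "'g \<Rightarrow> 'x \<Rightarrow> 'j \<Rightarrow> real" and I :: "'a set"
  assumes D: "finite (set_pmf D)" and J: "finite J" and G: "G \<noteq> {}" and L: "0 \<le> L"
    and lip: "\<And>g g' x. g \<in> G \<Longrightarrow> g' \<in> G \<Longrightarrow> f g x - f g' x \<le> L * sqrt (\<Sum>j\<in>J. (v g x j - v g' x j)\<^sup>2)"
    and f: "\<And>x. bounded ((\<lambda>g. f g x) ` G)" and mean: "bounded ((\<lambda>g. measure_pmf.expectation D (f g)) ` G)"
    and v: "\<And>x j. j \<in> J \<Longrightarrow> bounded ((\<lambda>g. v g x j) ` G)"
    and I: "finite I" and B: "bounded (B ` G)"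
  shows "measure_pmf.expectation (Pi_pmf I d (\<lambda>_. D))
      (\<lambda>xs. SUP g\<in>G. (\<Sum>i\<in>I. measure_pmf.expectation D (f g) - f g (xs i)) + B g) \<le>
    measure_pmf.expectation (Pi_pmf I d (\<lambda>_. D)) (\<lambda>xs. sign_avg (I \<times> J)
      (\<lambda>s. SUP g\<in>G. 2 * sqrt 2 * L * (\<Sum>i\<in>I. \<Sum>j\<in>J. s (i, j) * v g (xs i) j) + B g))"
  using I B
proof (induction I arbitrary: B rule: finite_induct)
  case (insert a I B)
  define E :: "(('a \<Rightarrow> 'x) \<Rightarrow> real) \<Rightarrow> real"
    where "E = measure_pmf.expectation (Pi_pmf I d (\<lambda>_. D))"
  define E1 :: "('x \<Rightarrow> real) \<Rightarrow> real" where "E1 = measure_pmf.expectation D"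
  define c where "c = 2 * sqrt 2 * L"
  define W where "W xs s g = c * (\<Sum>i\<in>I. \<Sum>j\<in>J. s (i, j) * v g (xs i) j)" for xs s g
  have finI: "finite (set_pmf (Pi_pmf I d (\<lambda>_. D)))"
    using insert.hyps D by (intro finite_set_Pi_pmf) auto
  have finIJ: "finite (I \<times> J)" and fin1: "finite ({a} \<times> J)"
    using insert.hyps J by auto
  have fins: "finite (set_pmf (Pi_pmf (I \<times> J) 0 (\<lambda>_. pmf_of_set {-1, 1 :: real})))"
    using finIJ by (intro finite_set_Pi_pmf) auto
  have swap: "E (\<lambda>xs. E1 (F xs)) = E1 (\<lambda>x. E (\<lambda>xs. F xs x))" for F
    unfolding E_def E1_def by (rule expectation_swap_finite[OF finI D])
  have swap_sign: "E1 (\<lambda>x. sign_avg (I \<times> J) (F x)) = sign_avg (I \<times> J) (\<lambda>s. E1 (\<lambda>x. F x s))" for F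
    unfolding sign_avg_def E1_def by (rule expectation_swap_finite[OF D fins])
  have E_mono: "E F \<le> E F'" if "\<And>xs. F xs \<le> F' xs" for F F'
    unfolding E_def using that by (intro expectation_mono_finite[OF finI])
  have E1_mono: "E1 F \<le> E1 F'" if "\<And>x. F x \<le> F' x" for F F'
    unfolding E1_def using that by (intro expectation_mono_finite[OF D])
  have E_insert: "measure_pmf.expectation (Pi_pmf (insert a I) d (\<lambda>_. D)) F = E (\<lambda>xs. E1 (\<lambda>x. F (xs(a := x))))" for F
    unfolding E_def E1_def using insert.hyps D by (intro expectation_Pi_pmf_insert) auto
  have sum_upd: "(\<Sum>i\<in>I. F i ((xs(a := x)) i)) = (\<Sum>i\<in>I. F i (xs i))" for F :: "_ \<Rightarrow> _ \<Rightarrow> real" and xs x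
    using insert.hyps by (intro sum.cong) auto
  have row: "(\<Sum>k\<in>{a} \<times> J. F k) = (\<Sum>j\<in>J. F (a, j))" for F :: "_ \<Rightarrow> real"
  proof -
    have "{a} \<times> J = Pair a ` J"
      by auto
    then show ?thesis
      by (simp add: sum.reindex inj_on_def)
  qed
  have W_bounded: "bounded (W xs s ` G)" for xs s
    unfolding W_def[abs_def] using v by (intro bounded_comp) auto

  have "measure_pmf.expectation (Pi_pmf (insert a I) d (\<lambda>_. D))
      (\<lambda>xs. SUP g\<in>G. (\<Sum>i\<in>insert a I. E1 (f g) - f g (xs i)) + B g) =
    E1 (\<lambda>x. E (\<lambda>xs. SUP g\<in>G. (\<Sum>i\<in>I. E1 (f g) - f g (xs i)) + ((E1 (f g) - f g x) + B g)))"
    unfolding E_insert swap using insert.hyps sum_upd[of "\<lambda>i x. E1 (f _) - f _ x"]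
    by (simp add: sum_upd[of "\<lambda>i x. E1 (f _) - f _ x"] add_ac del: sum_subtractf)
  \<comment> \<open>With the new point \<open>x\<close> frozen, its deviation is part of the offset
    in the induction hypothesis.\<close>
  also have "\<dots> \<le> E1 (\<lambda>x. E (\<lambda>xs. sign_avg (I \<times> J) (\<lambda>s. SUP g\<in>G. W xs s g + ((E1 (f g) - f g x) + B g))))"
  proof (rule E1_mono)
    fix x
    have "bounded ((\<lambda>g. (E1 (f g) - f g x) + B g) ` G)"
      unfolding E1_def using insert.prems mean f by (intro bounded_comp)
    from insert.IH[OF this]
    show "E (\<lambda>xs. SUP g\<in>G. (\<Sum>i\<in>I. E1 (f g) - f g (xs i)) + ((E1 (f g) - f g x) + B g)) \<le>
        E (\<lambda>xs. sign_avg (I \<times> J) (\<lambda>s. SUP g\<in>G. W xs s g + ((E1 (f g) - f g x) + B g)))"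
      by (simp add: E_def E1_def W_def c_def)
  qed
  \<comment> \<open>The average over \<open>x\<close> is moved innermost, where the Rademacher sum
    \<open>W\<close> of the old points is a fixed offset.\<close>
  also have "\<dots> = E (\<lambda>xs. sign_avg (I \<times> J) (\<lambda>s. E1 (\<lambda>x. SUP g\<in>G. (E1 (f g) - f g x) + (W xs s g + B g))))"
    by (simp add: swap[symmetric] swap_sign add_ac)
  also have "\<dots> \<le> E (\<lambda>xs. sign_avg (I \<times> J) (\<lambda>s. E1 (\<lambda>x. sign_avg ({a} \<times> J)
      (\<lambda>t. SUP g\<in>G. c * (\<Sum>j\<in>J. t (a, j) * v g x j) + (W xs s g + B g)))))"
  proof (intro E_mono sign_avg_mono finIJ)
    fix xs s
    have "bounded ((\<lambda>g. W xs s g + B g) ` G)"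
      using W_bounded insert.prems by (rule bounded_plus_comp)
    moreover have "bounded ((\<lambda>g. v g x (snd k)) ` G)" if "k \<in> {a} \<times> J" for x k
      using that by (intro v) auto
    ultimately show "E1 (\<lambda>x. SUP g\<in>G. (E1 (f g) - f g x) + (W xs s g + B g)) \<le>
        E1 (\<lambda>x. sign_avg ({a} \<times> J) (\<lambda>t. SUP g\<in>G. c * (\<Sum>j\<in>J. t (a, j) * v g x j) + (W xs s g + B g)))"
      using symmetrization_step[OF D fin1 G L, of f "\<lambda>g x k. v g x (snd k)" "\<lambda>g. W xs s g + B g"] lip f
      by (simp add: E1_def c_def row)
  qed
  also have "\<dots> = E (\<lambda>xs. E1 (\<lambda>x. sign_avg (insert a I \<times> J)
      (\<lambda>s. SUP g\<in>G. c * (\<Sum>i\<in>insert a I. \<Sum>j\<in>J. s (i, j) * v g ((xs(a := x)) i) j) + B g)))"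
  proof -
    have "insert a I \<times> J = I \<times> J \<union> {a} \<times> J" "(I \<times> J) \<inter> ({a} \<times> J) = {}"
      using insert.hyps by auto
    moreover have "(\<Sum>i\<in>insert a I. \<Sum>j\<in>J. (if (i, j) \<in> I \<times> J then s (i, j) else t (i, j)) * v g ((xs(a := x)) i) j) =
      (\<Sum>j\<in>J. t (a, j) * v g x j) + (\<Sum>i\<in>I. \<Sum>j\<in>J. s (i, j) * v g (xs i) j)" for s t xs x g
    proof -
      have "(\<Sum>i\<in>I. \<Sum>j\<in>J. (if (i, j) \<in> I \<times> J then s (i, j) else t (i, j)) * v g ((xs(a := x)) i) j) =
          (\<Sum>i\<in>I. \<Sum>j\<in>J. s (i, j) * v g (xs i) j)"
        using insert.hyps by (intro sum.cong) auto
      then show ?thesis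
        using insert.hyps by simp
    qed
    ultimately show ?thesis
      by (simp add: sign_avg_union[OF finIJ fin1] swap_sign[symmetric] W_def distrib_left add_ac
          del: fun_upd_apply mem_Sigma_iff)
  qed
  finally show ?case
    unfolding E_insert by (simp add: c_def E1_def E_insert)
qed simp

section \<open>McDiarmid's inequality\<close>

lemma hoeffding_mgf_pmf:
  fixes h :: "'a \<Rightarrow> real"
  assumes D: "finite (set_pmf D)" and c: "\<And>x y. \<bar>h x - h y\<bar> \<le> c" and l: "0 < l"
  shows "measure_pmf.expectation D (\<lambda>x. exp (l * (h x - measure_pmf.expectation D h))) \<le> exp (l\<^sup>2 * c\<^sup>2 / 8)"
proof -
  \<comment> \<open>The minimum over the finite support gives an interval of length exactly
    \<open>c\<close> containing the values of \<open>h\<close>.\<close>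
  obtain z where z: "\<And>x. x \<in> set_pmf D \<Longrightarrow> h z \<le> h x"
    using ex_min_if_finite[of "h ` set_pmf D"] D set_pmf_not_empty[of D] by (fastforce simp: not_less)
  interpret interval_bounded_random_variable "measure_pmf D" h "h z" "h z + c"
    using z c[of _ z] by unfold_locales (auto simp: AE_measure_pmf_iff abs_le_iff algebra_simps)
  show ?thesis
    using Hoeffdings_lemma_nn_integral[OF l]
    by (subst (asm) nn_integral_eq_integral) (auto intro: integrable_measure_pmf_finite[OF D])
qed

text \<open>The martingale argument as an induction: averaging out coordinate \<open>a\<close>
  yields \<open>F\<close>, which inherits the bounded differences in the other coordinates, and the
  fluctuation around \<open>F\<close> is handled by Hoeffding's lemma.\<close>

lemma mcdiarmid_mgf:
  fixes f :: "('i \<Rightarrow> 'a) \<Rightarrow> real"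
  assumes "finite A" and "\<And>i. i \<in> A \<Longrightarrow> finite (set_pmf (D i))"
    and "\<And>i s x y. i \<in> A \<Longrightarrow> \<bar>f (s(i := x)) - f (s(i := y))\<bar> \<le> c i" and l: "0 < l"
  shows "measure_pmf.expectation (Pi_pmf A d D)
      (\<lambda>s. exp (l * (f s - measure_pmf.expectation (Pi_pmf A d D) f))) \<le> exp (l\<^sup>2 * (\<Sum>i\<in>A. (c i)\<^sup>2) / 8)"
  using assms(1-3)
proof (induction A arbitrary: f rule: finite_induct)
  case (insert a A f)
  define E :: "(('i \<Rightarrow> 'a) \<Rightarrow> real) \<Rightarrow> real" where "E = measure_pmf.expectation (Pi_pmf A d D)"
  define E1 :: "('a \<Rightarrow> real) \<Rightarrow> real" where "E1 = measure_pmf.expectation (D a)"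
  define F where "F s = E1 (\<lambda>x. f (s(a := x)))" for s
  have fin: "finite (set_pmf (Pi_pmf A d D))" and fin1: "finite (set_pmf (D a))"
    using insert.hyps insert.prems by (auto intro!: finite_set_Pi_pmf)
  have E_insert: "measure_pmf.expectation (Pi_pmf (insert a A) d D) h = E (\<lambda>s. E1 (\<lambda>x. h (s(a := x))))"
    for h :: "_ \<Rightarrow> real"
    unfolding E_def E1_def using insert.hyps insert.prems by (intro expectation_Pi_pmf_insert) auto
  have "\<bar>F (s(i := x)) - F (s(i := y))\<bar> \<le> c i" if "i \<in> A" for i s x y
  proof -
    have "\<bar>f (s(i := x, a := z)) - f (s(i := y, a := z))\<bar> \<le> c i" for z
    proof -
      have "s(i := w, a := z) = s(a := z, i := w)" for w
        using insert.hyps that by (intro fun_upd_twist) auto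
      then show ?thesis
        using insert.prems(2)[of i "s(a := z)" x y] that by (simp del: fun_upd_apply)
    qed
    then have "E1 (\<lambda>z. \<bar>f (s(i := x, a := z)) - f (s(i := y, a := z))\<bar>) \<le> E1 (\<lambda>_. c i)"
      unfolding E1_def by (intro expectation_mono_finite[OF fin1])
    moreover have "F (s(i := x)) - F (s(i := y)) = E1 (\<lambda>z. f (s(i := x, a := z)) - f (s(i := y, a := z)))"
      unfolding F_def E1_def
      by (intro Bochner_Integration.integral_diff[symmetric] integrable_measure_pmf_finite[OF fin1])
    ultimately show ?thesis
      by (auto simp: E1_def intro: order.trans[OF integral_abs_bound])
  qed
  then have IH: "E (\<lambda>s. exp (l * (F s - E F))) \<le> exp (l\<^sup>2 * (\<Sum>i\<in>A. (c i)\<^sup>2) / 8)"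
    unfolding E_def using insert.prems by (intro insert.IH) (auto simp del: fun_upd_apply)
  have "E (\<lambda>s. E1 (\<lambda>x. exp (l * (f (s(a := x)) - E F)))) \<le> E (\<lambda>s. exp (l\<^sup>2 * (c a)\<^sup>2 / 8) * exp (l * (F s - E F)))"
    unfolding E_def
  proof (rule expectation_mono_finite[OF fin], fold E_def)
    fix s
    \<comment> \<open>The exponent is split at \<open>F s\<close>; the second factor is constant in
      \<open>x\<close>.\<close>
    have "E1 (\<lambda>x. exp (l * (f (s(a := x)) - E F))) = E1 (\<lambda>x. exp (l * (f (s(a := x)) - F s))) * exp (l * (F s - E F))"
      by (simp add: E1_def exp_add[symmetric] flip: integral_mult_left_zero) (simp add: algebra_simps)
    also have "\<dots> \<le> exp (l\<^sup>2 * (c a)\<^sup>2 / 8) * exp (l * (F s - E F))"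
      unfolding E1_def F_def using insert.prems
      by (intro mult_right_mono hoeffding_mgf_pmf[OF fin1 _ l]) (auto simp del: fun_upd_apply)
    finally show "E1 (\<lambda>x. exp (l * (f (s(a := x)) - E F))) \<le> exp (l\<^sup>2 * (c a)\<^sup>2 / 8) * exp (l * (F s - E F))" .
  qed
  also have "\<dots> \<le> exp (l\<^sup>2 * (c a)\<^sup>2 / 8) * exp (l\<^sup>2 * (\<Sum>i\<in>A. (c i)\<^sup>2) / 8)"
    using IH by (simp add: E_def)
  also have "\<dots> = exp (l\<^sup>2 * (\<Sum>i\<in>insert a A. (c i)\<^sup>2) / 8)"
    using insert.hyps by (simp add: exp_add[symmetric] distrib_left add_divide_distrib)
  finally show ?case
    by (simp add: E_insert F_def[abs_def])
qed simp

theorem mcdiarmid: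
  fixes f :: "('i \<Rightarrow> 'a) \<Rightarrow> real"
  assumes A: "finite A" and D: "\<And>i. i \<in> A \<Longrightarrow> finite (set_pmf (D i))"
    and c: "\<And>i s x y. i \<in> A \<Longrightarrow> \<bar>f (s(i := x)) - f (s(i := y))\<bar> \<le> c i"
    and pos: "0 < (\<Sum>i\<in>A. (c i)\<^sup>2)" and t: "0 < t"
  shows "measure_pmf.prob (Pi_pmf A d D) {s. f s - measure_pmf.expectation (Pi_pmf A d D) f \<ge> t} \<le>
    exp (- 2 * t\<^sup>2 / (\<Sum>i\<in>A. (c i)\<^sup>2))"
proof -
  define C where "C = (\<Sum>i\<in>A. (c i)\<^sup>2)"
  define \<mu> where "\<mu> = measure_pmf.expectation (Pi_pmf A d D) f"
  \<comment> \<open>The minimizer of the Chernoff exponent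
    \<open>l\<^sup>2 * C / 8 - l * t\<close>.\<close>
  define l where "l = 4 * t / C"
  have l: "0 < l"
    using pos t by (simp add: l_def C_def)
  have "{s. f s - \<mu> \<ge> t} = {s \<in> space (measure_pmf (Pi_pmf A d D)). exp (l * (f s - \<mu>)) \<ge> exp (l * t)}"
    using l by simp
  then have "measure_pmf.prob (Pi_pmf A d D) {s. f s - \<mu> \<ge> t} \<le>
      measure_pmf.expectation (Pi_pmf A d D) (\<lambda>s. exp (l * (f s - \<mu>))) / exp (l * t)"
    using A D
    by (simp only:) (intro integral_Markov_inequality_measure[where A = "{}"] integrable_measure_pmf_finite
        finite_set_Pi_pmf; simp)
  also have "\<dots> \<le> exp (l\<^sup>2 * C / 8) / exp (l * t)"
    unfolding \<mu>_def C_def using mcdiarmid_mgf[where f = f and c = c, OF A D c l] by (intro divide_right_mono) auto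
  also have "\<dots> = exp (l\<^sup>2 * C / 8 - l * t)"
    by (simp add: exp_diff)
  also have "l\<^sup>2 * C / 8 - l * t = - 2 * t\<^sup>2 / C"
    using pos by (simp add: l_def C_def[symmetric] power2_eq_square field_simps)
  finally show ?thesis
    by (simp add: \<mu>_def C_def)
qed

section \<open>Uniform deviations\<close>

text \<open>Provides the bounded differences of a supremum of deviations, as McDiarmid's inequality
  requires them.\<close>

lemma abs_SUP_diff_le:
  fixes a b :: "'g \<Rightarrow> real"
  assumes G: "G \<noteq> {}" and bdd: "bounded (a ` G)" "bounded (b ` G)"
    and diff: "\<And>g. g \<in> G \<Longrightarrow> \<bar>a g - b g\<bar> \<le> c"
  shows "\<bar>(SUP g\<in>G. a g) - (SUP g\<in>G. b g)\<bar> \<le> c"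
proof -
  have "a g \<le> (SUP g\<in>G. b g) + c" "b g \<le> (SUP g\<in>G. a g) + c" if "g \<in> G" for g
    using bounded_imp_le_SUP[OF bdd(1) that] bounded_imp_le_SUP[OF bdd(2) that] diff[OF that] by auto
  then have "(SUP g\<in>G. a g) \<le> (SUP g\<in>G. b g) + c" "(SUP g\<in>G. b g) \<le> (SUP g\<in>G. a g) + c"
    using G by (auto intro!: cSUP_least)
  then show ?thesis
    by auto
qed

text \<open>The bound for a single component: McDiarmid controls the supremum of the deviations
  around its expectation, and the contraction result controls that expectation.\<close>

lemma uniform_deviation:
  fixes G :: "('x \<Rightarrow> nat \<Rightarrow> real) set" and f :: "('x \<Rightarrow> nat \<Rightarrow> real) \<Rightarrow> 'x \<Rightarrow> real"
  assumes D: "finite (set_pmf D)" and G: "G \<noteq> {}" and L: "0 \<le> L" and M: "0 < M" and m: "0 < m"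
    and lip: "\<And>g g' x. g \<in> G \<Longrightarrow> g' \<in> G \<Longrightarrow> f g x - f g' x \<le> L * sqrt (\<Sum>j=1..p. (g x j - g' x j)\<^sup>2)"
    and range: "\<And>g x. g \<in> G \<Longrightarrow> 0 \<le> f g x \<and> f g x \<le> M"
    and bdd: "\<And>x j. j \<in> {1..p} \<Longrightarrow> bounded ((\<lambda>g. g x j) ` G)"
    and \<eta>: "0 < \<eta>" "\<eta> < 1"
  shows "measure_pmf.prob (Pi_pmf {0..<m} undefined (\<lambda>_. D))
    {xs. \<not> (\<forall>g\<in>G. measure_pmf.expectation D (f g) \<le> (\<Sum>i<m. f g (xs i)) / m +
      (2 * sqrt 2 * L * rademacher p G D m + M * sqrt (ln (1 / \<eta>) / (2 * m))))} \<le> \<eta>"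
proof -
  define Q where "Q = Pi_pmf {0..<m} undefined (\<lambda>_. D)"
  define mean where "mean g = measure_pmf.expectation D (f g)" for g
  define \<Psi> where "\<Psi> xs = (SUP g\<in>G. \<Sum>i\<in>{0..<m}. mean g - f g (xs i))" for xs
  \<comment> \<open>Makes \<open>exp (- 2 * t\<^sup>2 / (m * M\<^sup>2))\<close> equal to
    \<open>\<eta>\<close>. The factor \<open>m\<close> is due to \<open>\<Psi>\<close> being a
    supremum of sums, not of averages.\<close>
  define t where "t = m * (M * sqrt (ln (1 / \<eta>) / (2 * m)))"
  have finQ: "finite (set_pmf Q)"
    unfolding Q_def using D by (intro finite_set_Pi_pmf) auto
  have f_bdd: "bounded ((\<lambda>g. f g x) ` G)" for x
    using range[of _ x] by (intro boundedI[of _ M]) auto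
  have "0 \<le> mean g \<and> mean g \<le> M" if "g \<in> G" for g
    using range[OF that] expectation_mono_finite[OF D, of "\<lambda>_. 0" "f g"]
      expectation_mono_finite[OF D, of "f g" "\<lambda>_. M"] by (simp add: mean_def)
  then have mean_bdd: "bounded (mean ` G)"
    by (intro boundedI[of _ M]) auto
  have dev_bdd: "bounded ((\<lambda>g. \<Sum>i\<in>{0..<m}. mean g - f g (xs i)) ` G)" for xs
    using f_bdd mean_bdd by (intro bounded_sum_comp bounded_minus_comp)

  have mean_\<Psi>: "measure_pmf.expectation Q \<Psi> \<le> 2 * sqrt 2 * L * (m * rademacher p G D m)"
  proof -
    let ?T = "\<lambda>xs s g. \<Sum>i\<in>{0..<m}. \<Sum>j=1..p. s (i, j) * g (xs i) j"
    have T_bdd: "bounded ((\<lambda>g. ?T xs s g) ` G)" for xs s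
      using bdd by (intro bounded_sum_comp bounded_cmult_comp)
    have "measure_pmf.expectation Q \<Psi> \<le> measure_pmf.expectation Q
        (\<lambda>xs. sign_avg ({0..<m} \<times> {1..p}) (\<lambda>s. SUP g\<in>G. 2 * sqrt 2 * L * ?T xs s g))"
      using symmetrization_contraction[where v = "\<lambda>g. g" and f = f and J = "{1..p}" and I = "{0..<m}"
          and B = "\<lambda>_. 0" and d = undefined, OF D _ G L lip]
        f_bdd mean_bdd bdd
      by (simp add: Q_def \<Psi>_def[abs_def] mean_def[abs_def] bounded_const_comp)
    also have "\<dots> \<le> measure_pmf.expectation Q
        (\<lambda>xs. sign_avg ({0..<m} \<times> {1..p}) (\<lambda>s. 2 * sqrt 2 * L * (SUP g\<in>G. ?T xs s g)))"
      using L by (intro expectation_mono_finite[OF finQ] sign_avg_mono cSUP_least[OF G] mult_left_mono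
          bounded_imp_le_SUP[OF T_bdd]) auto
    also have "\<dots> = 2 * sqrt 2 * L * (m * rademacher p G D m)"
      using m by (simp add: rademacher_def Q_def sign_avg_cmult lessThan_atLeast0) (simp add: sign_avg_def)
    finally show ?thesis .
  qed

  have "\<bar>\<Psi> (xs(i := x)) - \<Psi> (xs(i := y))\<bar> \<le> M" if i: "i \<in> {0..<m}" for xs i x y
    unfolding \<Psi>_def
  proof (rule abs_SUP_diff_le[OF G dev_bdd dev_bdd])
    fix g assume g: "g \<in> G"
    \<comment> \<open>Only one summand depends on the replaced point, and the losses lie in an
      interval of length \<open>M\<close>.\<close>
    have "(\<Sum>k\<in>{0..<m}. mean g - f g ((xs(i := z)) k)) =
        mean g - f g z + (\<Sum>k\<in>{0..<m} - {i}. mean g - f g (xs k))" for z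
      using i by (simp add: sum.remove[of _ i] del: sum_subtractf)
    then show "\<bar>(\<Sum>k\<in>{0..<m}. mean g - f g ((xs(i := x)) k)) - (\<Sum>k\<in>{0..<m}. mean g - f g ((xs(i := y)) k))\<bar> \<le> M"
      using range[OF g, of x] range[OF g, of y] by (auto simp: abs_le_iff simp del: fun_upd_apply)
  qed
  moreover have ln_pos: "0 < ln (1 / \<eta>)"
    using \<eta> by (intro ln_gt_zero) auto
  then have "0 < t"
    using m M by (simp add: t_def)
  ultimately have "measure_pmf.prob Q {xs. \<Psi> xs - measure_pmf.expectation Q \<Psi> \<ge> t} \<le>
      exp (- 2 * t\<^sup>2 / (\<Sum>i\<in>{0..<m}. M\<^sup>2))"
    unfolding Q_def using D m M by (intro mcdiarmid) auto
  also have "- 2 * t\<^sup>2 / (\<Sum>i\<in>{0..<m}. M\<^sup>2) = - ln (1 / \<eta>)"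
    using ln_pos m M by (simp add: t_def power_mult_distrib) (simp add: power2_eq_square field_simps)
  also have "exp (- ln (1 / \<eta>)) = \<eta>"
    using \<eta> by (simp add: ln_div)
  finally have "measure_pmf.prob Q {xs. \<Psi> xs - measure_pmf.expectation Q \<Psi> \<ge> t} \<le> \<eta>" .
  \<comment> \<open>Failure of the bound at some \<open>g\<close>, multiplied by \<open>m\<close>,
    pushes \<open>\<Psi>\<close> at least \<open>t\<close> above its expectation.\<close>
  moreover have "measure_pmf.prob Q {xs. \<not> (\<forall>g\<in>G. mean g \<le> (\<Sum>i<m. f g (xs i)) / m +
      (2 * sqrt 2 * L * rademacher p G D m + M * sqrt (ln (1 / \<eta>) / (2 * m))))} \<le>
    measure_pmf.prob Q {xs. \<Psi> xs - measure_pmf.expectation Q \<Psi> \<ge> t}"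
  proof (intro measure_pmf.finite_measure_mono subsetI CollectI; (elim CollectE)?)
    fix xs
    assume "\<not> (\<forall>g\<in>G. mean g \<le> (\<Sum>i<m. f g (xs i)) / m +
      (2 * sqrt 2 * L * rademacher p G D m + M * sqrt (ln (1 / \<eta>) / (2 * m))))"
    then obtain g where g: "g \<in> G" and "(\<Sum>i<m. f g (xs i)) / m +
      (2 * sqrt 2 * L * rademacher p G D m + M * sqrt (ln (1 / \<eta>) / (2 * m))) < mean g"
      by (auto simp: not_le)
    then have "m * ((\<Sum>i<m. f g (xs i)) / m +
      (2 * sqrt 2 * L * rademacher p G D m + M * sqrt (ln (1 / \<eta>) / (2 * m)))) < m * mean g"
      using m by simp
    then have "(\<Sum>i<m. f g (xs i)) + 2 * sqrt 2 * L * (m * rademacher p G D m) + t < m * mean g"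
      using m by (simp only: distrib_left t_def) (simp add: mult_ac)
    moreover have "m * mean g - (\<Sum>i<m. f g (xs i)) \<le> \<Psi> xs"
      using bounded_imp_le_SUP[OF dev_bdd g, of xs] by (simp add: \<Psi>_def sum_subtractf lessThan_atLeast0)
    ultimately show "t \<le> \<Psi> xs - measure_pmf.expectation Q \<Psi>"
      using mean_\<Psi> by linarith
  qed simp
  ultimately show ?thesis
    by (simp add: Q_def mean_def)
qed

section \<open>Gated mixtures of experts\<close>

text \<open>More than \<open>1 / e\<close> points would carry total mass above 1.\<close>

lemma finite_UNIV_of_pmf_bounded_below:
  fixes q :: "'x pmf"
  assumes e: "0 < e" and "\<And>x. e \<le> pmf q x"
  shows "finite (UNIV :: 'x set)"
proof (rule ccontr)
  assume "infinite (UNIV :: 'x set)"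
  moreover obtain n where n: "1 / e < real n"
    using reals_Archimedean2 by blast
  ultimately obtain F :: "'x set" where F: "finite F" "card F = n"
    using infinite_arbitrarily_large by blast
  have "n * e \<le> (\<Sum>x\<in>F. pmf q x)"
    using sum_bounded_below[of F e "pmf q"] assms(2) F by simp
  also have "\<dots> \<le> 1"
    using F by (simp add: measure_measure_pmf_finite[symmetric])
  finally show False
    using n e by (simp add: field_simps)
qed

lemma pi_g_bounds:
  assumes g: "is_gate p g" and "\<And>k. k \<in> {1..p} \<Longrightarrow> e \<le> pmf (pihat k) x"
  shows "e \<le> pi_g p pihat g x" and "pi_g p pihat g x \<le> 1"
proof -
  have nonneg: "k \<in> {1..p} \<Longrightarrow> 0 \<le> g x k" for k
    using g by (auto simp: is_gate_def)
  have sum: "(\<Sum>k=1..p. g x k) = 1"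
    using g by (auto simp: is_gate_def)
  have "e = (\<Sum>k=1..p. g x k * e)"
    using sum by (simp add: sum_distrib_right[symmetric])
  also have "\<dots> \<le> pi_g p pihat g x"
    unfolding pi_g_def using assms nonneg by (intro sum_mono mult_left_mono) auto
  finally show "e \<le> pi_g p pihat g x" .
  have "pi_g p pihat g x \<le> (\<Sum>k=1..p. g x k * 1)"
    unfolding pi_g_def using nonneg by (intro sum_mono mult_left_mono pmf_le_1) auto
  then show "pi_g p pihat g x \<le> 1"
    using sum by simp
qed

text \<open>Cauchy-Schwarz at a fixed \<open>x\<close>; the first factor is the quantity whose
  supremum is \<open>C_Pi\<close>.\<close>

lemma pi_g_lipschitz:
  "\<bar>pi_g p pihat g x - pi_g p pihat g' x\<bar> \<le>
    sqrt (\<Sum>k=1..p. (pmf (pihat k) x)\<^sup>2) * sqrt (\<Sum>k=1..p. (g x k - g' x k)\<^sup>2)"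
proof -
  have "\<bar>pi_g p pihat g x - pi_g p pihat g' x\<bar> = \<bar>\<Sum>k=1..p. pmf (pihat k) x * (g x k - g' x k)\<bar>"
    by (simp add: pi_g_def sum_subtractf[symmetric] algebra_simps)
  also have "\<dots> \<le> (\<Sum>k=1..p. \<bar>pmf (pihat k) x\<bar> * \<bar>g x k - g' x k\<bar>)"
    by (rule order.trans[OF sum_abs]) (simp add: abs_mult)
  also have "\<dots> \<le> sqrt (\<Sum>k=1..p. (pmf (pihat k) x)\<^sup>2) * sqrt (\<Sum>k=1..p. (g x k - g' x k)\<^sup>2)"
    using L2_set_mult_ineq[of "\<lambda>k. pmf (pihat k) x" "\<lambda>k. g x k - g' x k" "{1..p}"] by (simp add: L2_set_def)
  finally show ?thesis .
qed

text \<open>Follows from \<open>ln y \<le> y - 1\<close> at \<open>y = b / a\<close>.\<close>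

lemma ln_diff_le:
  fixes a b e :: real
  assumes "0 < e" "e \<le> a" "e \<le> b"
  shows "ln b - ln a \<le> \<bar>b - a\<bar> / e"
proof -
  have "ln b - ln a = ln (b / a)"
    using assms by (simp add: ln_div)
  also have "\<dots> \<le> b / a - 1"
    using assms by (intro ln_le_minus_one) auto
  also have "\<dots> = (b - a) / a"
    using assms by (simp add: diff_divide_distrib)
  also have "\<dots> \<le> \<bar>b - a\<bar> / e"
    using assms by (intro frac_le) auto
  finally show ?thesis .
qed

section \<open>Mixtures and the union bound over the components\<close>

lemma expect_w_mix_pmf:
  assumes "finite (UNIV :: 'x set)"
  shows "expect_w (mix_pmf p lam P) (f :: 'x \<Rightarrow> real) = (\<Sum>k=1..p. lam k * measure_pmf.expectation (P k) f)"
  using assms sum.swap[of "\<lambda>x k. lam k * (pmf (P k) x * f x)" "{1..p}" UNIV]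
  by (simp add: expect_w_def mix_pmf_def integral_measure_pmf[OF assms] sum_distrib_left sum_distrib_right mult.assoc)

lemma expect_w_empirical_mixture:
  assumes "finite (UNIV :: 'x set)"
  shows "expect_w (\<lambda>x. \<Sum>k=1..p. lam k * empirical (m k) (S k) x) (f :: 'x \<Rightarrow> real) =
    (\<Sum>k=1..p. lam k * ((\<Sum>i<m k. f (S k i)) / m k))"
proof -
  have emp: "(\<Sum>x\<in>UNIV. empirical n xs x * f x) = (\<Sum>i<n. f (xs i)) / n" for n xs
  proof -
    \<comment> \<open>The sample points are grouped by their value; the count of each group becomes
      a sum over it.\<close>
    have "(\<Sum>x\<in>UNIV. empirical n xs x * f x) = (\<Sum>x\<in>UNIV. \<Sum>i\<in>{i\<in>{0..<n}. xs i = x}. f (xs i)) / n"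
      by (simp add: empirical_def sum_divide_distrib)
    also have "\<dots> = (\<Sum>i<n. f (xs i)) / n"
      unfolding lessThan_atLeast0 using assms by (intro arg_cong[where f = "\<lambda>s. s / n"] sum.group) auto
    finally show ?thesis .
  qed
  show ?thesis
    using assms sum.swap[of "\<lambda>x k. lam k * (empirical (m k) (S k) x * f x)" "{1..p}" UNIV]
    by (simp add: expect_w_def sum_distrib_right mult.assoc emp sum_distrib_left[symmetric])
qed

lemma prob_Pi_pmf_component:
  assumes "finite A" "k \<in> A"
  shows "measure_pmf.prob (Pi_pmf A d D) {S. Q (S k)} = measure_pmf.prob (D k) {x. Q x}"
proof -
  have "measure_pmf.prob (D k) {x. Q x} = measure_pmf.prob (map_pmf (\<lambda>S. S k) (Pi_pmf A d D)) {x. Q x}"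
    using assms by (simp add: Pi_pmf_component)
  then show ?thesis
    by (simp add: vimage_def)
qed

text \<open>Union bound over the bad events; each concerns one component, so its probability is that
  under the marginal.\<close>

lemma prob_all_components_ge:
  fixes \<eta> :: real
  assumes A: "finite A" and Q: "\<And>k. k \<in> A \<Longrightarrow> measure_pmf.prob (D k) {x. \<not> Q k x} \<le> \<eta>"
  shows "1 - card A * \<eta> \<le> measure_pmf.prob (Pi_pmf A d D) {S. \<forall>k\<in>A. Q k (S k)}"
proof -
  have "measure_pmf.prob (Pi_pmf A d D) (\<Union>k\<in>A. {S. \<not> Q k (S k)}) \<le>
      (\<Sum>k\<in>A. measure_pmf.prob (Pi_pmf A d D) {S. \<not> Q k (S k)})"
    using A by (intro measure_pmf.finite_measure_subadditive_finite) auto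
  also have "\<dots> \<le> (\<Sum>k\<in>A. \<eta>)"
    using A Q by (intro sum_mono) (simp add: prob_Pi_pmf_component[where Q = "\<lambda>x. \<not> Q _ x"])
  also have "(\<Union>k\<in>A. {S. \<not> Q k (S k)}) = UNIV - {S. \<forall>k\<in>A. Q k (S k)}"
    by auto
  finally show ?thesis
    using measure_pmf.prob_compl[of "{S. \<forall>k\<in>A. Q k (S k)}" "Pi_pmf A d D"] by simp
qed

theorem mainTheorem11:
  fixes p :: nat and P pihat :: "nat \<Rightarrow> ('x::countable) pmf" and M :: real
    and m :: "nat \<Rightarrow> nat" and \<delta> :: real
  assumes "p \<ge> 1"
    and "M > 0"
    and "\<And>x k. k \<in> {1..p} \<Longrightarrow> pmf (pihat k) x > 0"
    and "\<And>x k. k \<in> {1..p} \<Longrightarrow> \<bar>ln (pmf (pihat k) x)\<bar> \<le> M"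
    and "\<And>k. k \<in> {1..p} \<Longrightarrow> m k \<ge> 1"
    and "0 < \<delta>" and "\<delta> < 1"
  shows "measure_pmf.prob (sample_pmf p m P)
           {S. \<forall>g\<in>G1 p pihat. \<forall>lam\<in>lam_simplex p.
              expect_w (mix_pmf p lam P) (\<lambda>x. - ln (pi_g p pihat g x))
              \<le> expect_w (\<lambda>x. \<Sum>k=1..p. lam k * empirical (m k) (S k) x) (\<lambda>x. - ln (pi_g p pihat g x))
                + (\<Sum>k=1..p. lam k *
                    (2 * sqrt 2 * C_Pi p pihat * exp M * rademacher p (G1 p pihat) (P k) (m k)
                     + M * sqrt (ln (real p / \<delta>) / (2 * real (m k)))))}
         \<ge> 1 - \<delta>"
proof -
  \<comment> \<open>As \<open>ln\<close> is a total function, it is the positivity of the masses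
    that lets the bound be exponentiated.\<close>
  have pmf_ge: "exp (- M) \<le> pmf (pihat k) x" if "k \<in> {1..p}" for k x
    using assms(4)[OF that, of x] assms(3)[OF that, of x] by (simp add: ln_ge_iff[symmetric] abs_le_iff)
  have fin: "finite (UNIV :: 'x set)"
    using pmf_ge[of 1] assms(1) by (intro finite_UNIV_of_pmf_bounded_below[of "exp (- M)"]) auto
  define G where "G = G1 p pihat"
  define f where "f g x = - ln (pi_g p pihat g x)" for g x
  have gate: "is_gate p g" if "g \<in> G" for g
    using that by (simp add: G_def G1_def)
  have pi_g_ge: "exp (- M) \<le> pi_g p pihat g x" and pi_g_le: "pi_g p pihat g x \<le> 1" if "g \<in> G" for g x
    using pi_g_bounds[OF gate[OF that], of "exp (- M)" pihat x] pmf_ge by auto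
  \<comment> \<open>The gate that always selects the first expert is admissible, so the suprema
    range over a nonempty class.\<close>
  have "(\<lambda>_ k. if k = 1 then 1 else 0) \<in> G"
    using assms(1) fin
    by (simp add: G_def G1_def is_gate_def pi_g_def if_distrib[where f = "\<lambda>c. c * _"] sum_pmf_eq_1 cong: if_cong)
  then have G_nonempty: "G \<noteq> {}"
    by auto
  have C_upper: "sqrt (\<Sum>k=1..p. (pmf (pihat k) x)\<^sup>2) \<le> C_Pi p pihat" for x
    unfolding C_Pi_def using fin by (intro cSUP_upper bounded_imp_bdd_above finite_imp_bounded) auto
  then have C_nonneg: "0 \<le> C_Pi p pihat"
    by (rule order.trans[rotated]) (simp add: sum_nonneg)
  have lip: "f g x - f g' x \<le> C_Pi p pihat * exp M * sqrt (\<Sum>j=1..p. (g x j - g' x j)\<^sup>2)"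
    if "g \<in> G" "g' \<in> G" for g g' x
  proof -
    \<comment> \<open>On values at least \<open>exp (- M)\<close> the logarithm has Lipschitz
      constant \<open>exp M\<close>; Cauchy-Schwarz then contributes \<open>C_Pi\<close>.\<close>
    have "f g x - f g' x \<le> \<bar>pi_g p pihat g' x - pi_g p pihat g x\<bar> / exp (- M)"
      unfolding f_def using ln_diff_le[OF _ pi_g_ge[OF that(1)] pi_g_ge[OF that(2)], of x x]
      by simp
    also have "\<dots> = exp M * \<bar>pi_g p pihat g x - pi_g p pihat g' x\<bar>"
      by (simp add: exp_minus field_simps abs_minus_commute)
    also have "\<dots> \<le> exp M * (C_Pi p pihat * sqrt (\<Sum>j=1..p. (g x j - g' x j)\<^sup>2))"
      using C_upper
      by (intro mult_left_mono order.trans[OF pi_g_lipschitz] mult_right_mono) (auto simp: sum_nonneg)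
    finally show ?thesis
      by (simp add: mult_ac)
  qed
  have range: "0 \<le> f g x \<and> f g x \<le> M" if "g \<in> G" for g x
  proof -
    have "0 < pi_g p pihat g x"
      using pi_g_ge[OF that, of x] exp_gt_zero[of "- M"] by linarith
    then show ?thesis
      using pi_g_ge[OF that, of x] pi_g_le[OF that, of x] by (simp add: f_def ln_ge_iff[symmetric])
  qed
  have gate_bdd: "bounded ((\<lambda>g. g x j) ` G)" if "j \<in> {1..p}" for x j
    using that gate by (intro boundedI[of _ 1]) (auto simp: is_gate_def)
  \<comment> \<open>Each component receives the failure probability \<open>\<delta> / p\<close>,
    hence the logarithm of \<open>p / \<delta>\<close>.\<close>
  define \<epsilon> where "\<epsilon> k = 2 * sqrt 2 * (C_Pi p pihat * exp M) * rademacher p G (P k) (m k)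
      + M * sqrt (ln (1 / (\<delta> / p)) / (2 * real (m k)))" for k
  define good where "good k xs \<longleftrightarrow> (\<forall>g\<in>G. measure_pmf.expectation (P k) (f g) \<le>
      (\<Sum>i<m k. f g (xs i)) / m k + \<epsilon> k)" for k xs
  have "measure_pmf.prob (Pi_pmf {0..<m k} undefined (\<lambda>_. P k)) {xs. \<not> good k xs} \<le> \<delta> / p"
    if "k \<in> {1..p}" for k
  proof -
    have "0 < m k"
      using assms(5)[OF that] by simp
    then show ?thesis
      unfolding good_def \<epsilon>_def using assms(1,2,6,7) C_nonneg finite_subset[OF subset_UNIV fin]
      by (intro uniform_deviation G_nonempty lip range gate_bdd) (auto simp: field_simps)
  qed
  then have "1 - \<delta> \<le> measure_pmf.prob (sample_pmf p m P) {S. \<forall>k\<in>{1..p}. good k (S k)}"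
    using prob_all_components_ge[of "{1..p}" "\<lambda>k. Pi_pmf {0..<m k} undefined (\<lambda>_. P k)" good "\<delta> / p"] assms(1)
    by (simp add: sample_pmf_def)
  also have "\<dots> \<le> measure_pmf.prob (sample_pmf p m P)
           {S. \<forall>g\<in>G1 p pihat. \<forall>lam\<in>lam_simplex p.
              expect_w (mix_pmf p lam P) (\<lambda>x. - ln (pi_g p pihat g x))
              \<le> expect_w (\<lambda>x. \<Sum>k=1..p. lam k * empirical (m k) (S k) x) (\<lambda>x. - ln (pi_g p pihat g x))
                + (\<Sum>k=1..p. lam k *
                    (2 * sqrt 2 * C_Pi p pihat * exp M * rademacher p (G1 p pihat) (P k) (m k)
                     + M * sqrt (ln (real p / \<delta>) / (2 * real (m k)))))}"
  proof (intro measure_pmf.finite_measure_mono subsetI CollectI ballI; (elim CollectE)?)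
    fix S g lam
    assume good: "\<forall>k\<in>{1..p}. good k (S k)" and g: "g \<in> G1 p pihat" and lam: "lam \<in> lam_simplex p"
    \<comment> \<open>The good event does not involve \<open>lam\<close>, so weighting the component
      bounds covers all mixtures simultaneously.\<close>
    have "(\<Sum>k=1..p. lam k * measure_pmf.expectation (P k) (f g)) \<le>
        (\<Sum>k=1..p. lam k * ((\<Sum>i<m k. f g (S k i)) / m k + \<epsilon> k))"
      using good g lam
      by (intro sum_mono mult_left_mono) (auto simp: good_def G_def lam_simplex_def)
    also have "\<dots> = (\<Sum>k=1..p. lam k * ((\<Sum>i<m k. f g (S k i)) / m k)) + (\<Sum>k=1..p. lam k * \<epsilon> k)"
      by (simp add: distrib_left sum.distrib)
    finally show "expect_w (mix_pmf p lam P) (\<lambda>x. - ln (pi_g p pihat g x))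
              \<le> expect_w (\<lambda>x. \<Sum>k=1..p. lam k * empirical (m k) (S k) x) (\<lambda>x. - ln (pi_g p pihat g x))
                + (\<Sum>k=1..p. lam k *
                    (2 * sqrt 2 * C_Pi p pihat * exp M * rademacher p (G1 p pihat) (P k) (m k)
                     + M * sqrt (ln (real p / \<delta>) / (2 * real (m k)))))"
      unfolding expect_w_mix_pmf[OF fin] expect_w_empirical_mixture[OF fin] f_def[abs_def] \<epsilon>_def G_def
      by (simp add: mult.assoc)
  qed simp
  finally show ?thesis .
qed

end
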